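(* For $n\geq1$, $a_n(312,4321:312)=Q_{n+3}$, where $Q_n$ is the $n$-th Tetranacci number.
   Context: $\mathcal{S}_n$ is the set of permutations of $\{1,\ldots,n\}$ in one-line form; $\pi^2=\pi\circ\pi$. A permutation contains a pattern $\sigma\in\mathcal{S}_k$ if some subsequence of it (not necessarily consecutive) has the same relative order as $\sigma$; otherwise it avoids $\sigma$. $a_n(312,4321:\sigma)$ is the number of $\pi\in\mathcal{S}_n$ such that $\pi$ avoids both $312$ and $4321$ and $\pi^2$ avoids $\sigma$. Tetranacci numbers: $Q_0=Q_1=Q_2=0$, $Q_3=1$, $Q_n=Q_{n-1}+Q_{n-2}+Q_{n-3}+Q_{n-4}$ for $n\ge4$. *)

theory Defs
  imports "HOL-Combinatorics.Permutations" "HOL-Library.Sublist"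
begin

text \<open>Permutations of \<open>{1..n}\<close> are functions \<open>p\<close> with \<open>p permutes {1..n}\<close>; the one-line form is
  the word \<open>p 1, ..., p n\<close>.\<close>

definition one_line :: "nat \<Rightarrow> (nat \<Rightarrow> nat) \<Rightarrow> nat list" where
  "one_line n p = map p [1..<Suc n]"

definition same_relative_order :: "nat list \<Rightarrow> nat list \<Rightarrow> bool" where
  "same_relative_order xs ys \<longleftrightarrow> length xs = length ys \<and>
     (\<forall>i<length xs. \<forall>j<length xs. xs ! i < xs ! j \<longleftrightarrow> ys ! i < ys ! j)"

definition contains_pattern :: "nat list \<Rightarrow> nat list \<Rightarrow> bool" where
  "contains_pattern w \<sigma> \<longleftrightarrow> (\<exists>xs. subseq xs w \<and> same_relative_order xs \<sigma>)"

definition avoids :: "nat list \<Rightarrow> nat list \<Rightarrow> bool" where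
  "avoids w \<sigma> \<longleftrightarrow> \<not> contains_pattern w \<sigma>"

text \<open>For a set \<open>T\<close> of patterns and a pattern \<open>\<sigma>\<close>, all given in one-line form, this is the number
  \<open>a\<^sub>n(T : \<sigma>)\<close> of permutations that avoid every pattern in \<open>T\<close> and whose square avoids \<open>\<sigma>\<close>.\<close>

definition num_avoiding_sq :: "nat \<Rightarrow> nat list set \<Rightarrow> nat list \<Rightarrow> nat" where
  "num_avoiding_sq n T \<sigma> =
     card {p. p permutes {1..n} \<and> (\<forall>\<tau>\<in>T. avoids (one_line n p) \<tau>) \<and>
              avoids (one_line n (p \<circ> p)) \<sigma>}"

fun tetranacci :: "nat \<Rightarrow> nat" where
  "tetranacci 0 = 0"
| "tetranacci (Suc 0) = 0"
| "tetranacci (Suc (Suc 0)) = 0"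
| "tetranacci (Suc (Suc (Suc 0))) = 1"
| "tetranacci (Suc (Suc (Suc (Suc n)))) =
     tetranacci (Suc (Suc (Suc n))) + tetranacci (Suc (Suc n)) + tetranacci (Suc n) + tetranacci n"

end

theory Submission
  imports Defs
begin

text \<open>
  Let \<open>p\<close> avoid \<open>312\<close> and let \<open>j\<close> be the position of the entry \<open>1\<close>. An entry before position
  \<open>j\<close> that exceeds an entry after it would form a \<open>312\<close> with the \<open>1\<close>, so \<open>p\<close> maps \<open>{1..j}\<close> to
  itself and is a direct sum of a block of size \<open>j\<close> that ends in \<open>1\<close> and a permutation of the
  remaining \<open>n - j\<close> points. Squaring commutes with direct sums, and a direct sum avoids a
  pattern that starts higher than it ends if and only if both summands do
  (\<open>contains_pattern_append\<close>). Call \<open>p\<close> admissible if it avoids \<open>312\<close> and \<open>4321\<close> and its square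
  avoids \<open>312\<close>. The admissible permutations are then exactly the sums of an admissible block
  that ends in \<open>1\<close> and a smaller admissible permutation.

  The point is that there are only four such blocks, \<open>1\<close>, \<open>21\<close>, \<open>321\<close> and \<open>3421\<close>, one of
  each size up to four (\<open>leading_block_cases\<close>). Let the block \<open>a\<close> have size \<open>m \<ge> 2\<close> and let
  \<open>a k = m\<close>. As \<open>a m = 1\<close>, its square has the entry \<open>1\<close> at position \<open>k\<close>; the square avoids
  \<open>312\<close>, so the argument above, applied to the square, shows that its last entry, which is
  \<open>a 1\<close>, exceeds \<open>k\<close>. On the other hand the entries of \<open>a\<close> below \<open>a 1\<close> occur in decreasing
  order, since \<open>a\<close> avoids \<open>312\<close>, and avoiding \<open>4321\<close> then gives \<open>a 1 \<le> 3\<close>. Thus either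
  \<open>k = 1\<close> and \<open>m = a 1 \<le> 3\<close>, or \<open>k = 2\<close> and \<open>a 1 = 3\<close>; in the second case the entries after the
  \<open>m\<close> at position \<open>2\<close> decrease, which forces \<open>m = 4\<close>.

  Removing the leading block therefore yields the Tetranacci recurrence.
\<close>

section \<open>Occurrences of patterns\<close>

lemma subseq_map_strict_sorted:
  assumes "sorted_wrt (<) zs" "set zs \<subseteq> {1..n}"
  shows "subseq (map f zs) (one_line n f)"
  unfolding one_line_def using assms
  by (intro subseq_map sorted_subset_imp_subseq) (auto simp del: upt_Suc)

lemma avoids_312D:
  assumes "avoids (one_line n f) [3, 1, 2]" "1 \<le> i" "i < j" "j < k" "k \<le> n" "f j < f k"
  shows "f i \<le> f k"
proof (rule ccontr)
  assume "\<not> f i \<le> f k"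
  then have "same_relative_order (map f [i, j, k]) [3, 1, 2]"
    using assms by (auto simp: same_relative_order_def less_Suc_eq numeral_3_eq_3)
  moreover have "subseq (map f [i, j, k]) (one_line n f)"
    by (rule subseq_map_strict_sorted) (use assms in auto)
  ultimately show False
    using assms(1) unfolding avoids_def contains_pattern_def by blast
qed

lemma avoids_4321D:
  assumes "avoids (one_line n f) [4, 3, 2, 1]" "1 \<le> i" "i < j" "j < k" "k < l" "l \<le> n"
    "f l < f k" "f k < f j"
  shows "f i \<le> f j"
proof (rule ccontr)
  assume "\<not> f i \<le> f j"
  then have "same_relative_order (map f [i, j, k, l]) [4, 3, 2, 1]"
    using assms by (auto simp: same_relative_order_def less_Suc_eq)
  moreover have "subseq (map f [i, j, k, l]) (one_line n f)"
    by (rule subseq_map_strict_sorted) (use assms in auto)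
  ultimately show False
    using assms(1) unfolding avoids_def contains_pattern_def by blast
qed

section \<open>Patterns in direct sums\<close>

lemma same_relative_order_map_add:
  "same_relative_order (map ((+) c) xs) \<sigma> \<longleftrightarrow> same_relative_order xs \<sigma>"
  by (auto simp: same_relative_order_def)

lemma contains_pattern_map_add:
  "contains_pattern (map ((+) c) w) \<sigma> \<longleftrightarrow> contains_pattern w \<sigma>"
proof
  assume "contains_pattern (map ((+) c) w) \<sigma>"
  then obtain N where "same_relative_order (nths (map ((+) c) w) N) \<sigma>"
    unfolding contains_pattern_def subseq_conv_nths by blast
  then have "same_relative_order (nths w N) \<sigma>"
    by (simp add: nths_map same_relative_order_map_add)
  then show "contains_pattern w \<sigma>"
    unfolding contains_pattern_def subseq_conv_nths by blast
next
  assume "contains_pattern w \<sigma>"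
  then show "contains_pattern (map ((+) c) w) \<sigma>"
    unfolding contains_pattern_def by (meson subseq_map same_relative_order_map_add)
qed

text \<open>An occurrence of the pattern starts higher than it ends, so it cannot start in the lower
  word \<open>u\<close> and end in the upper word \<open>v\<close>.\<close>

lemma contains_pattern_append:
  assumes "\<And>x y. x \<in> set u \<Longrightarrow> y \<in> set v \<Longrightarrow> x < y" and "last \<sigma> < hd \<sigma>"
  shows "contains_pattern (u @ v) \<sigma> \<longleftrightarrow> contains_pattern u \<sigma> \<or> contains_pattern v \<sigma>"
proof
  assume "contains_pattern (u @ v) \<sigma>"
  then obtain xs ys where xs: "subseq xs u" and ys: "subseq ys v"
    and so: "same_relative_order (xs @ ys) \<sigma>"
    unfolding contains_pattern_def by (auto elim!: subseq_appendE)
  have "xs = [] \<or> ys = []"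
  proof (rule ccontr)
    assume "\<not> ?thesis"
    then have ne: "xs \<noteq> []" "ys \<noteq> []" by auto
    have "hd xs < last ys"
      using assms(1) xs ys ne by (metis hd_in_set last_in_set subseq_conv_nths in_set_nthsD)
    then have "(xs @ ys) ! 0 < (xs @ ys) ! (length (xs @ ys) - 1)"
      using ne by (metis append_is_Nil_conv hd_append2 hd_conv_nth last_appendR last_conv_nth)
    moreover have len: "length \<sigma> = length (xs @ ys)" "\<sigma> \<noteq> []"
      using so ne by (auto simp: same_relative_order_def)
    ultimately have "\<sigma> ! 0 < \<sigma> ! (length \<sigma> - 1)"
      using so unfolding same_relative_order_def
      by (metis diff_less length_greater_0_conv zero_less_one)
    then show False
      using assms(2) len by (simp add: hd_conv_nth last_conv_nth)
  qed
  then show "contains_pattern u \<sigma> \<or> contains_pattern v \<sigma>"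
    using xs ys so unfolding contains_pattern_def by auto
next
  assume "contains_pattern u \<sigma> \<or> contains_pattern v \<sigma>"
  then show "contains_pattern (u @ v) \<sigma>"
    unfolding contains_pattern_def by (meson subseq_drop_many subseq_rev_drop_many)
qed

definition direct_sum :: "nat \<Rightarrow> (nat \<Rightarrow> nat) \<Rightarrow> (nat \<Rightarrow> nat) \<Rightarrow> nat \<Rightarrow> nat" where
  "direct_sum m a b x = (if x \<le> m then a x else m + b (x - m))"

lemma permutes_direct_sum:
  assumes a: "a permutes {1..m}" and b: "b permutes {1..k}"
  shows "direct_sum m a b permutes {1..m + k}"
proof (rule bij_imp_permutes)
  have "inj_on (direct_sum m a b) {1..m + k}"
  proof (rule inj_onI)
    fix x y assume "x \<in> {1..m + k}" "y \<in> {1..m + k}" "direct_sum m a b x = direct_sum m a b y"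
    then show "x = y"
      using permutes_in_image[OF a, of x] permutes_in_image[OF a, of y]
        permutes_in_image[OF b, of "x - m"] permutes_in_image[OF b, of "y - m"]
        injD[OF permutes_inj[OF a], of x y] injD[OF permutes_inj[OF b], of "x - m" "y - m"]
      by (auto simp: direct_sum_def split: if_splits)
  qed
  moreover have "direct_sum m a b ` {1..m + k} \<subseteq> {1..m + k}"
  proof
    fix y assume "y \<in> direct_sum m a b ` {1..m + k}"
    then obtain x where "x \<in> {1..m + k}" "y = direct_sum m a b x" by auto
    then show "y \<in> {1..m + k}"
      using permutes_in_image[OF a, of x] permutes_in_image[OF b, of "x - m"]
      by (auto simp: direct_sum_def split: if_splits)
  qed
  ultimately show "bij_betw (direct_sum m a b) {1..m + k} {1..m + k}"
    by (simp add: bij_betw_def endo_inj_surj)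
next
  fix x assume "x \<notin> {1..m + k}"
  then have "x = 0 \<or> m + k < x" by auto
  moreover have "a 0 = 0" using permutes_not_in[OF a] by simp
  moreover have "b (x - m) = x - m" if "m + k < x"
    using that by (intro permutes_not_in[OF b]) auto
  ultimately show "direct_sum m a b x = x" by (auto simp: direct_sum_def)
qed

lemma direct_sum_comp:
  assumes a: "a permutes {1..m}" and b: "b permutes {1..k}"
  shows "direct_sum m a b \<circ> direct_sum m a b = direct_sum m (a \<circ> a) (b \<circ> b)"
proof
  fix x
  have "a x \<le> m" if "x \<le> m"
    using that permutes_in_image[OF a, of x] permutes_not_in[OF a, of x] by (cases "x = 0") auto
  moreover have "b (x - m) \<noteq> 0" if "m < x"
    using that permutes_not_in[OF b, of 0] injD[OF permutes_inj[OF b], of "x - m" 0] by auto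
  ultimately show "(direct_sum m a b \<circ> direct_sum m a b) x = direct_sum m (a \<circ> a) (b \<circ> b) x"
    by (auto simp: direct_sum_def)
qed

lemma one_line_direct_sum:
  "one_line (m + k) (direct_sum m a b) = one_line m a @ map ((+) m) (one_line k b)"
proof (rule nth_equalityI)
  fix i assume "i < length (one_line (m + k) (direct_sum m a b))"
  then show "one_line (m + k) (direct_sum m a b) ! i
      = (one_line m a @ map ((+) m) (one_line k b)) ! i"
    by (auto simp: one_line_def direct_sum_def nth_append Suc_diff_le simp del: upt_Suc)
qed (simp add: one_line_def)

lemma set_one_line: "p permutes {1..n} \<Longrightarrow> set (one_line n p) = {1..n}"
  by (metis atLeastLessThanSuc_atLeastAtMost list.set_map one_line_def permutes_image set_upt)

lemma avoids_direct_sum: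
  assumes a: "a permutes {1..m}" and b: "b permutes {1..k}" and "last \<sigma> < hd \<sigma>"
  shows "avoids (one_line (m + k) (direct_sum m a b)) \<sigma>
    \<longleftrightarrow> avoids (one_line m a) \<sigma> \<and> avoids (one_line k b) \<sigma>"
proof -
  have "contains_pattern (one_line m a @ map ((+) m) (one_line k b)) \<sigma>
      \<longleftrightarrow> contains_pattern (one_line m a) \<sigma> \<or> contains_pattern (map ((+) m) (one_line k b)) \<sigma>"
    by (rule contains_pattern_append) (use assms in \<open>auto simp: set_one_line\<close>)
  then show ?thesis
    by (simp add: avoids_def one_line_direct_sum contains_pattern_map_add)
qed

section \<open>Splitting off the leading block\<close>

text \<open>The entries at positions up to \<open>k\<close> are \<open>k\<close> distinct positive numbers, and by the absence
  of \<open>312\<close> all of them are below \<open>p b\<close>.\<close>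

lemma avoids_312_after_one:
  assumes p: "p permutes {1..n}" and av: "avoids (one_line n p) [3, 1, 2]"
    and k: "p k = 1" and b: "k < b" "b \<le> n"
  shows "k < p b"
proof -
  have inj: "inj p" using p by (rule permutes_inj)
  have pb: "p b \<in> {1..n}" using permutes_in_image[OF p, of b] b by auto
  have "p b \<noteq> 1" using injD[OF inj, of b k] k b by auto
  then have "1 < p b" using pb by auto
  have "p ` {1..k} \<subseteq> {1..<p b}"
  proof
    fix y assume "y \<in> p ` {1..k}"
    then obtain i where i: "1 \<le> i" "i \<le> k" "y = p i" by auto
    have "p i \<in> {1..n}" using permutes_in_image[OF p, of i] i b by auto
    moreover have "p i < p b"
    proof (cases "i = k")
      case False
      then have "p i \<le> p b"
        using avoids_312D[OF av i(1), of k b] i b k \<open>1 < p b\<close> by simp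
      moreover have "p i \<noteq> p b" using injD[OF inj, of i b] i b by auto
      ultimately show ?thesis by simp
    qed (use k \<open>1 < p b\<close> in simp)
    ultimately show "y \<in> {1..<p b}" using i by simp
  qed
  then have "card (p ` {1..k}) \<le> card {1..<p b}" by (intro card_mono) auto
  then have "k \<le> p b - 1" using inj by (simp add: card_image inj_on_subset)
  then show ?thesis using \<open>1 < p b\<close> by simp
qed

text \<open>By injectivity, a permutation that maps the upper interval into itself also preserves
  the lower one.\<close>

lemma permutes_split:
  assumes p: "p permutes {1..m + k}" and up: "\<And>x. m < x \<Longrightarrow> x \<le> m + k \<Longrightarrow> m < p x"
  obtains a b where "a permutes {1..m}" "b permutes {1..k}" "p = direct_sum m a b"
proof -
  have inj: "inj p" using p by (rule permutes_inj)
  have "p ` {m<..m + k} \<subseteq> {m<..m + k}"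
    using up permutes_in_image[OF p] by fastforce
  then have upper: "p ` {m<..m + k} = {m<..m + k}"
    using inj by (intro endo_inj_surj) (auto intro: inj_on_subset)
  have low: "p x \<in> {1..m}" if "x \<in> {1..m}" for x
  proof (rule ccontr)
    assume "p x \<notin> {1..m}"
    then have "p x \<in> {m<..m + k}" using permutes_in_image[OF p, of x] that by auto
    then have "p x \<in> p ` {m<..m + k}" using upper by simp
    then have "x \<in> {m<..m + k}" using inj by (simp add: inj_image_mem_iff)
    then show False using that by simp
  qed
  define a where "a x = (if x \<in> {1..m} then p x else x)" for x
  define b where "b x = (if x \<in> {1..k} then p (m + x) - m else x)" for x
  have "a permutes {1..m}"
  proof (rule bij_imp_permutes)
    have "inj_on a {1..m}" using inj by (auto simp: a_def inj_on_def)
    moreover have "a ` {1..m} \<subseteq> {1..m}" using low by (auto simp: a_def)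
    ultimately show "bij_betw a {1..m} {1..m}" by (simp add: bij_betw_def endo_inj_surj)
  qed (auto simp: a_def)
  moreover have "b permutes {1..k}"
  proof (rule bij_imp_permutes)
    have up': "p (m + x) \<in> {m<..m + k}" if "x \<in> {1..k}" for x
      using that upper by (metis add.commute add_le_cancel_right atLeastAtMost_iff
          greaterThanAtMost_iff imageI less_add_same_cancel2 less_eq_Suc_le One_nat_def)
    have "inj_on b {1..k}"
    proof (rule inj_onI)
      fix x y assume xy: "x \<in> {1..k}" "y \<in> {1..k}" "b x = b y"
      then have "p (m + x) = p (m + y)" using up'[of x] up'[of y] by (auto simp: b_def)
      then show "x = y" using injD[OF inj] by fastforce
    qed
    moreover have "b ` {1..k} \<subseteq> {1..k}"
      using up' by (fastforce simp: b_def)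
    ultimately show "bij_betw b {1..k} {1..k}" by (simp add: bij_betw_def endo_inj_surj)
  qed (auto simp: b_def)
  moreover have "p = direct_sum m a b"
  proof
    fix x
    consider "x = 0" | "x \<in> {1..m}" | "m < x" "x \<le> m + k" | "m + k < x"
      by fastforce
    then show "p x = direct_sum m a b x"
    proof cases
      case 3
      then show ?thesis using up[of x] by (auto simp: direct_sum_def b_def)
    qed (use permutes_not_in[OF p, of x] in \<open>auto simp: direct_sum_def a_def b_def\<close>)
  qed
  ultimately show ?thesis using that by blast
qed

section \<open>The admissible blocks\<close>

definition admissible :: "nat \<Rightarrow> (nat \<Rightarrow> nat) set" where
  "admissible n = {p. p permutes {1..n} \<and> (\<forall>\<tau>\<in>{[3, 1, 2], [4, 3, 2, 1]}. avoids (one_line n p) \<tau>)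
     \<and> avoids (one_line n (p \<circ> p)) [3, 1, 2]}"

lemma admissible_direct_sum:
  assumes a: "a permutes {1..m}" and b: "b permutes {1..k}"
  shows "direct_sum m a b \<in> admissible (m + k) \<longleftrightarrow> a \<in> admissible m \<and> b \<in> admissible k"
  using permutes_direct_sum[OF a b] avoids_direct_sum[OF a b]
    avoids_direct_sum[OF permutes_compose[OF a a] permutes_compose[OF b b]] a b
  by (auto simp: admissible_def direct_sum_comp[OF a b])

text \<open>In one-line form these are \<open>1\<close>, \<open>21\<close>, \<open>321\<close> and \<open>3421\<close>. As products of transpositions they
  are permutations without further proof.\<close>

definition block :: "nat \<Rightarrow> nat \<Rightarrow> nat" where
  "block m = (if m = 4 then transpose 1 2 \<circ> transpose 1 3 \<circ> transpose 2 4 else transpose 1 m)"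

lemma permutes_block: "m \<in> {1..4} \<Longrightarrow> block m permutes {1..m}"
  unfolding block_def by (auto intro!: permutes_compose permutes_swap_id)

lemma block_last: "m \<in> {1..4} \<Longrightarrow> block m m = 1"
  by (auto simp: block_def transpose_def)

text \<open>With bounded quantifiers over explicit lists, the simplifier decides avoidance for
  concrete words.\<close>

lemma avoids_by_enumeration:
  "avoids w \<sigma> \<longleftrightarrow> list_all (\<lambda>xs. length xs = length \<sigma> \<longrightarrow> \<not> list_all (\<lambda>i.
     list_all (\<lambda>j. xs ! i < xs ! j \<longleftrightarrow> \<sigma> ! i < \<sigma> ! j) [0..<length \<sigma>]) [0..<length \<sigma>]) (subseqs w)"
  by (auto simp: avoids_def contains_pattern_def same_relative_order_def list_all_iff Ball_def)

lemma block_admissible: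
  assumes "m \<in> {1..4}"
  shows "block m \<in> admissible m"
proof -
  consider "m = 1" | "m = 2" | "m = 3" | "m = 4" using assms by fastforce
  then have "(\<forall>\<tau>\<in>{[3, 1, 2], [4, 3, 2, 1]}. avoids (one_line m (block m)) \<tau>)
     \<and> avoids (one_line m (block m \<circ> block m)) [3, 1, 2]"
  proof cases
    case 1
    then have "one_line m (block m) = [1]" "one_line m (block m \<circ> block m) = [1]"
      by (simp_all add: one_line_def block_def transpose_def upt_conv_Cons)
    then show ?thesis by (simp add: avoids_by_enumeration)
  next
    case 2
    then have "one_line m (block m) = [2, 1]" "one_line m (block m \<circ> block m) = [1, 2]"
      by (simp_all add: one_line_def block_def transpose_def upt_conv_Cons)
    then show ?thesis by (simp add: avoids_by_enumeration)
  next
    case 3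
    then have "one_line m (block m) = [3, 2, 1]" "one_line m (block m \<circ> block m) = [1, 2, 3]"
      by (simp_all add: one_line_def block_def transpose_def upt_conv_Cons)
    then show ?thesis by (simp add: avoids_by_enumeration)
  next
    case 4
    then have "one_line m (block m) = [3, 4, 2, 1]" "one_line m (block m \<circ> block m) = [2, 1, 4, 3]"
      by (simp_all add: one_line_def block_def transpose_def upt_conv_Cons)
    then show ?thesis by (simp add: avoids_by_enumeration)
  qed
  then show ?thesis
    using permutes_block[OF assms] by (simp add: admissible_def)
qed

text \<open>The condition on the square enters through the position \<open>k\<close> of the maximum, which is
  where the square takes the value \<open>1\<close>. It gives \<open>k < a 1\<close>; without it there are infinitely many
  blocks, such as \<open>23\<dots>m1\<close>.\<close>

lemma leading_block_cases:
  assumes a: "a \<in> admissible m" and am: "a m = 1" and m: "1 \<le> m"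
  shows "m \<in> {1..4}" "a = block m"
proof -
  have perm: "a permutes {1..m}"
    and av3: "avoids (one_line m a) [3, 1, 2]"
    and av4: "avoids (one_line m a) [4, 3, 2, 1]"
    and avs: "avoids (one_line m (a \<circ> a)) [3, 1, 2]"
    using a by (auto simp: admissible_def)
  have inj: "a x = a y \<longleftrightarrow> x = y" for x y using permutes_inj[OF perm] by (simp add: inj_eq)
  have ran: "a x \<in> {1..m} \<longleftrightarrow> x \<in> {1..m}" for x using permutes_in_image[OF perm] .
  have pos: "\<exists>x\<in>{1..m}. a x = y" if "y \<in> {1..m}" for y
    using permutes_image[OF perm] that by (metis imageE)
  \<comment> \<open>Otherwise the entries \<open>a 1\<close>, \<open>3\<close>, \<open>2\<close>, \<open>1\<close> form a \<open>4321\<close>: were \<open>2\<close> to precede \<open>3\<close>, they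
    would form a \<open>312\<close> with \<open>a 1\<close>.\<close>
  have a1: "a 1 \<le> 3"
  proof (rule ccontr)
    assume gt: "\<not> a 1 \<le> 3"
    then have "3 < m" using ran[of 1] m by auto
    then obtain i2 i3 where i: "i2 \<in> {1..m}" "i3 \<in> {1..m}" "a i2 = 2" "a i3 = 3"
      using pos[of 2] pos[of 3] by auto
    have ne: "i2 \<noteq> 1" "i3 \<noteq> 1" "i2 \<noteq> m" "i2 \<noteq> i3" using gt i am by auto
    have "i3 < i2"
      using avoids_312D[OF av3, of 1 i2 i3] i ne gt by fastforce
    then show False
      using avoids_4321D[OF av4, of 1 i3 i2 m] i ne gt am by fastforce
  qed
  have fin: "m \<in> {1..4} \<and> (\<forall>x\<in>{1..m}. a x = block m x)"
  proof (cases "m = 1")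
    case True
    then show ?thesis using am by (auto simp: block_def)
  next
    case False
    obtain k where k: "k \<in> {1..m}" "a k = m" using pos[of m] m by auto
    then have "k \<noteq> m" using am False by auto
    \<comment> \<open>The square takes the value \<open>1\<close> at \<open>k\<close> and the value \<open>a 1\<close> at \<open>m\<close>.\<close>
    have "k < (a \<circ> a) m"
      by (rule avoids_312_after_one[OF permutes_compose[OF perm perm] avs])
         (use k am \<open>k \<noteq> m\<close> in auto)
    then have lt: "k < a 1" using am by simp
    then consider "k = 1" | "k = 2" "a 1 = 3" using a1 k by fastforce
    then show ?thesis
    proof cases
      case 1
      then have m23: "m = 2 \<or> m = 3" using a1 k False m by auto
      have "a 2 = 2" if "m = 3"
        using ran[of 2] inj[of 2 1] inj[of 2 3] that am k 1 by auto
      then show ?thesis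
        using m23 am k 1
        by (auto simp: block_def transpose_def numeral_eq_Suc atLeastAtMostSuc_conv)
    next
      case 2
      have m4: "4 \<le> m" using ran[of 1] inj[of 1 2] 2 k m by fastforce
      \<comment> \<open>An ascent after the maximum at position \<open>2\<close> would complete a \<open>312\<close>.\<close>
      have desc: "a y < a x" if "2 < x" "x < y" "y \<le> m" for x y
      proof -
        have "a y < m" using ran[of y] inj[of y 2] that 2 k by fastforce
        then show ?thesis
          using avoids_312D[OF av3, of 2 x y] that 2 k inj[of x y] by fastforce
      qed
      have "m \<le> 4"
      proof (rule ccontr)
        assume "\<not> m \<le> 4"
        moreover have "a 3 < m" using ran[of 3] inj[of 3 2] m4 2 k by fastforce
        ultimately show False
          using avoids_4321D[OF av4, of 2 3 4 5] desc[of 3 4] desc[of 4 5] 2 k by simp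
      qed
      with m4 have m: "m = 4" by simp
      have "a 3 = 2"
        using ran[of 3] inj[of 3 1] inj[of 3 2] inj[of 3 4] m am k 2 by auto
      then show ?thesis
        using m am k 2
        by (auto simp: block_def transpose_def numeral_eq_Suc atLeastAtMostSuc_conv)
    qed
  qed
  then show m4: "m \<in> {1..4}" by simp
  show "a = block m"
  proof
    fix x
    show "a x = block m x"
      using fin permutes_not_in[OF perm, of x] permutes_not_in[OF permutes_block[OF m4], of x]
      by (cases "x \<in> {1..m}") auto
  qed
qed

section \<open>Counting\<close>

lemma finite_admissible: "finite (admissible n)"
  by (rule finite_subset[of _ "{p. p permutes {1..n}}"]) (auto simp: admissible_def finite_permutations)

lemma admissible_decomposition:
  assumes "1 \<le> n"
  shows "admissible n = (\<Union>j\<in>{1..min 4 n}. direct_sum j (block j) ` admissible (n - j))"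
proof (intro equalityI subsetI)
  fix p assume p: "p \<in> admissible n"
  then have perm: "p permutes {1..n}" and av: "avoids (one_line n p) [3, 1, 2]"
    by (auto simp: admissible_def)
  obtain j where j: "j \<in> {1..n}" "p j = 1"
    using permutes_image[OF perm] assms by (metis atLeastAtMost_iff imageE order_refl)
  then have n: "n = j + (n - j)" by simp
  obtain a b where ab: "a permutes {1..j}" "b permutes {1..n - j}" "p = direct_sum j a b"
    using permutes_split[of p j "n - j"] avoids_312_after_one[OF perm av j(2)] perm n by metis
  then have good: "a \<in> admissible j" "b \<in> admissible (n - j)"
    using admissible_direct_sum[OF ab(1,2)] p n by auto
  moreover have "a j = 1" using j ab(3) by (simp add: direct_sum_def)
  ultimately have "j \<in> {1..4}" "a = block j"
    using leading_block_cases[of a j] j by auto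
  then show "p \<in> (\<Union>j\<in>{1..min 4 n}. direct_sum j (block j) ` admissible (n - j))"
    using ab good j by auto
next
  fix p assume "p \<in> (\<Union>j\<in>{1..min 4 n}. direct_sum j (block j) ` admissible (n - j))"
  then obtain j b where j: "j \<in> {1..4}" "j \<le> n" and b: "b \<in> admissible (n - j)"
    and p: "p = direct_sum j (block j) b" by auto
  then have "b permutes {1..n - j}" by (simp add: admissible_def)
  then show "p \<in> admissible n"
    using admissible_direct_sum[OF permutes_block[OF j(1)], of b "n - j"] block_admissible[OF j(1)]
      b p j by simp
qed

lemma card_admissible_rec:
  assumes "1 \<le> n"
  shows "card (admissible n) = (\<Sum>j\<in>{1..min 4 n}. card (admissible (n - j)))"
proof -
  have inj: "inj_on (direct_sum j (block j)) (admissible (n - j))" for j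
  proof (intro inj_onI ext)
    fix b c x assume b: "b \<in> admissible (n - j)" and c: "c \<in> admissible (n - j)"
      and eq: "direct_sum j (block j) b = direct_sum j (block j) c"
    show "b x = c x"
    proof (cases "x = 0")
      case True
      then show ?thesis
        using b c permutes_not_in[of b "{1..n - j}" 0] permutes_not_in[of c "{1..n - j}" 0]
        by (simp add: admissible_def)
    next
      case False
      then show ?thesis using fun_cong[OF eq, of "x + j"] by (simp add: direct_sum_def)
    qed
  qed
  \<comment> \<open>The size of the leading block is the position of the entry \<open>1\<close>.\<close>
  have one: "direct_sum j (block j) b j = 1" if "j \<in> {1..4}" for j b
    using block_last[OF that] by (simp add: direct_sum_def)
  have disj: "direct_sum i (block i) ` admissible (n - i)
      \<inter> direct_sum j (block j) ` admissible (n - j) = {}"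
    if ij: "i \<in> {1..min 4 n}" "j \<in> {1..min 4 n}" "i \<noteq> j" for i j
  proof (rule ccontr)
    assume "\<not> ?thesis"
    then obtain b c where eq: "direct_sum i (block i) b = direct_sum j (block j) c"
      and b: "b \<in> admissible (n - i)"
      by blast
    have "direct_sum i (block i) b permutes {1..i + (n - i)}"
      using ij b by (intro permutes_direct_sum permutes_block) (auto simp: admissible_def)
    moreover have "direct_sum i (block i) b i = direct_sum i (block i) b j"
      using one[of i b] one[of j c] ij eq by simp
    ultimately show False
      using ij(3) permutes_inj injD by metis
  qed
  have "card (admissible n)
      = (\<Sum>j\<in>{1..min 4 n}. card (direct_sum j (block j) ` admissible (n - j)))"
    unfolding admissible_decomposition[OF assms]
    by (rule card_UN_disjoint) (use disj in \<open>auto simp: finite_admissible\<close>)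
  then show ?thesis using inj by (simp add: card_image)
qed

lemma card_admissible: "card (admissible n) = tetranacci (n + 3)"
proof (induction n rule: less_induct)
  case (less n)
  show ?case
  proof (cases "n = 0")
    case True
    have "admissible 0 = {id}"
      by (auto simp: admissible_def one_line_def avoids_def contains_pattern_def
          same_relative_order_def)
    then show ?thesis using True by (simp add: numeral_3_eq_3)
  next
    case False
    have "card (admissible n) = (\<Sum>j\<in>{1..min 4 n}. tetranacci (n - j + 3))"
      using card_admissible_rec[of n] less.IH False by simp
    also have "\<dots> = (\<Sum>j\<in>{1..min 4 n}. tetranacci (n + 3 - j))"
      by (intro sum.cong) auto
    \<comment> \<open>For \<open>n < j \<le> 4\<close> the index \<open>n + 3 - j\<close> is below \<open>3\<close>, where the sequence vanishes.\<close>
    also have "\<dots> = (\<Sum>j\<in>{1..4}. tetranacci (n + 3 - j))"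
    proof (rule sum.mono_neutral_left)
      show "\<forall>j\<in>{1..4} - {1..min 4 n}. tetranacci (n + 3 - j) = 0"
      proof
        fix j assume "j \<in> {1..4} - {1..min 4 n}"
        then have "n + 3 - j < 3" by auto
        then have "n + 3 - j = 0 \<or> n + 3 - j = Suc 0 \<or> n + 3 - j = Suc (Suc 0)" by linarith
        then show "tetranacci (n + 3 - j) = 0" by auto
      qed
    qed auto
    also have "\<dots> = tetranacci (n + 2) + tetranacci (n + 1) + tetranacci n + tetranacci (n - 1)"
      by (simp add: numeral_eq_Suc)
    also have "\<dots> = tetranacci (n + 3)"
      using False by (cases n) (simp_all add: numeral_eq_Suc)
    finally show ?thesis .
  qed
qed

theorem theorem4p5:
  fixes n :: nat
  assumes "n \<ge> 1"
  shows "num_avoiding_sq n {[3, 1, 2], [4, 3, 2, 1]} [3, 1, 2] = tetranacci (n + 3)"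
  using card_admissible[of n] by (simp only: num_avoiding_sq_def admissible_def)

end
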